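(* Let $k\ge1$ and let $H_k$ be the vertex-disjoint union of $k$ copies of $K_2$. Then for all $n\ge 2k+1$, the uniform matroid ${\mathcal U}_{k-1}(E(K_n))$ of rank $k-1$ on $E(K_n)$ is the unique maximal $H_k$-matroid on $K_n$ (in the weak order), and ${\rm val}_{H_k}$ is its rank function.
   Context: An $H$-matroid on a graph $G$ is a matroid on $E(G)$ in which the edge set of every subgraph of $G$ isomorphic to $H$ is a circuit. Weak order: ${\mathcal M}_1\preceq{\mathcal M}_2$ if every independent set of ${\mathcal M}_1$ is independent in ${\mathcal M}_2$. Let ${\mathcal X}$ be the family of edge sets of subgraphs of $K_n$ isomorphic to $H$. A proper ${\mathcal X}$-sequence is a sequence $(X_1,\dots,X_m)$ of sets in ${\mathcal X}$ with $X_i\not\subseteq\bigcup_{j<i}X_j$ for $i\ge2$; for $F\subseteq E(K_n)$, ${\rm val}(F,{\mathcal S})=|F\cup\bigcup_iX_i|-m$, and ${\rm val}_H(F)=\min_{\mathcal S}{\rm val}(F,{\mathcal S})$ over all proper ${\mathcal X}$-sequences. *)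

theory Defs
  imports Main
begin

type_synonym 'v graph = "'v set \<times> 'v set set"

abbreviation vertices :: "'v graph \<Rightarrow> 'v set" where
  "vertices G \<equiv> fst G"

abbreviation edges :: "'v graph \<Rightarrow> 'v set set" where
  "edges G \<equiv> snd G"

definition simple_graph :: "'v graph \<Rightarrow> bool" where
  "simple_graph G \<longleftrightarrow> finite (vertices G) \<and> (\<forall>e\<in>edges G. e \<subseteq> vertices G \<and> card e = 2)"

definition complete_graph :: "nat \<Rightarrow> nat graph" where
  "complete_graph n = ({..<n}, {e. e \<subseteq> {..<n} \<and> card e = 2})"

definition disjoint_copies :: "nat \<Rightarrow> 'v graph \<Rightarrow> (nat \<times> 'v) graph" where
  "disjoint_copies k G =
     ({..<k} \<times> vertices G, {Pair i ` e | i e. i < k \<and> e \<in> edges G})"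

definition subgraph :: "'v graph \<Rightarrow> 'v graph \<Rightarrow> bool" where
  "subgraph G' G \<longleftrightarrow>
     simple_graph G' \<and> vertices G' \<subseteq> vertices G \<and> edges G' \<subseteq> edges G"

definition graph_iso :: "'v graph \<Rightarrow> 'w graph \<Rightarrow> bool" where
  "graph_iso G G' \<longleftrightarrow>
     (\<exists>f. bij_betw f (vertices G) (vertices G') \<and> edges G' = (\<lambda>e. f ` e) ` edges G)"

definition copies_in :: "'w graph \<Rightarrow> 'v graph \<Rightarrow> 'v set set set" where
  "copies_in H G = {edges G' | G'. subgraph G' G \<and> graph_iso H G'}"

text \<open>A matroid on a fixed ground set is represented by its family of independent sets.\<close>

definition matroid :: "'e set \<Rightarrow> 'e set set \<Rightarrow> bool" where
  "matroid E \<I> \<longleftrightarrow>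
     finite E \<and> \<I> \<subseteq> Pow E \<and> {} \<in> \<I> \<and>
     (\<forall>X Y. X \<in> \<I> \<and> Y \<subseteq> X \<longrightarrow> Y \<in> \<I>) \<and>
     (\<forall>X Y. X \<in> \<I> \<and> Y \<in> \<I> \<and> card X < card Y \<longrightarrow> (\<exists>e\<in>Y - X. insert e X \<in> \<I>))"

definition circuit :: "'e set \<Rightarrow> 'e set set \<Rightarrow> 'e set \<Rightarrow> bool" where
  "circuit E \<I> C \<longleftrightarrow> C \<subseteq> E \<and> C \<notin> \<I> \<and> (\<forall>D. D \<subset> C \<longrightarrow> D \<in> \<I>)"

definition matroid_rank :: "'e set set \<Rightarrow> 'e set \<Rightarrow> nat" where
  "matroid_rank \<I> F = Max {card X | X. X \<in> \<I> \<and> X \<subseteq> F}"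

definition uniform_matroid :: "nat \<Rightarrow> 'e set \<Rightarrow> 'e set set" where
  "uniform_matroid r E = {X. X \<subseteq> E \<and> card X \<le> r}"

definition weak_le :: "'e set set \<Rightarrow> 'e set set \<Rightarrow> bool" (infix "\<preceq>\<^sub>w" 50) where
  "\<I> \<preceq>\<^sub>w \<J> \<longleftrightarrow> (\<forall>X\<in>\<I>. X \<in> \<J>)"

definition H_matroid :: "'w graph \<Rightarrow> 'v graph \<Rightarrow> 'v set set set \<Rightarrow> bool" where
  "H_matroid H G \<I> \<longleftrightarrow>
     matroid (edges G) \<I> \<and> (\<forall>C\<in>copies_in H G. circuit (edges G) \<I> C)"

definition maximal_H_matroid :: "'w graph \<Rightarrow> 'v graph \<Rightarrow> 'v set set set \<Rightarrow> bool" where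
  "maximal_H_matroid H G \<I> \<longleftrightarrow>
     H_matroid H G \<I> \<and> (\<forall>\<J>. H_matroid H G \<J> \<and> \<I> \<preceq>\<^sub>w \<J> \<longrightarrow> \<J> = \<I>)"

text \<open>Sequences are lists indexed from \<open>0\<close>, so the condition for the second and later members
  is imposed at indices \<open>i \<ge> 1\<close>. The empty sequence is proper.\<close>

definition proper_seq :: "'e set set \<Rightarrow> 'e set list \<Rightarrow> bool" where
  "proper_seq \<X> S \<longleftrightarrow>
     set S \<subseteq> \<X> \<and> (\<forall>i. 1 \<le> i \<and> i < length S \<longrightarrow> \<not> S ! i \<subseteq> (\<Union>j<i. S ! j))"

definition seq_val :: "'e set \<Rightarrow> 'e set list \<Rightarrow> int" where
  "seq_val F S = int (card (F \<union> \<Union>(set S))) - int (length S)"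

text \<open>When the ground set is finite, the length of a proper sequence is bounded, so the minimum
  below is over a finite nonempty set.\<close>

definition val_in :: "'w graph \<Rightarrow> 'v graph \<Rightarrow> 'v set set \<Rightarrow> int" where
  "val_in H G F = Min {seq_val F S | S. proper_seq (copies_in H G) S}"

end

theory Submission imports Defs begin

text \<open>
  The copies of \<open>H\<^sub>k\<close> are the matchings with \<open>k\<close> edges. Call a set \<open>C\<close> of edges closed if it contains
  every edge that completes \<open>k - 1\<close> edges of \<open>C\<close> to a \<open>k\<close>-matching. A closed set containing a
  \<open>k\<close>-matching \<open>X\<close> is all of \<open>E(K\<^sub>n)\<close>: an edge meeting at most one edge of \<open>X\<close> is exchanged
  for it, and if \<open>uv\<close> meets \<open>uu'\<close> and \<open>vv'\<close> in \<open>X\<close>, one first exchanges \<open>uu'\<close> for \<open>u'w\<close>, where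
  \<open>w\<close> is a vertex missed by \<open>X\<close>, which exists since \<open>n \<ge> 2k + 1\<close>. Applied to the span of
  \<open>k - 1\<close> edges of a copy, this bounds the rank of every \<open>H\<^sub>k\<close>-matroid by \<open>k - 1\<close>. Applied to the union
  of a longest proper sequence in which each member after the first adds exactly one new edge, it gives
  a sequence of value \<open>k - 1\<close>.
\<close>

section \<open>Copies of a disjoint union of \<open>k\<close> edges as matchings\<close>

definition matchings :: "nat \<Rightarrow> 'v graph \<Rightarrow> 'v set set set" where
  "matchings k G = {X. X \<subseteq> edges G \<and> finite X \<and> card X = k \<and> pairwise disjnt X}"

lemma edges_complete_graph: "edges (complete_graph n) = {e. e \<subseteq> {..<n} \<and> card e = 2}"
  by (simp add: complete_graph_def)

lemma finite_edges_complete_graph: "finite (edges (complete_graph n))"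
  by (rule finite_subset[of _ "Pow {..<n}"]) (auto simp: edges_complete_graph)

lemma edges_complete_graph_2: "edges (complete_graph 2) = {{0, 1}}"
proof -
  have two: "{..<2::nat} = {0, 1}" by auto
  have "e = {0, 1}" if "e \<subseteq> {0, 1::nat}" "card e = 2" for e
    using that by (intro card_subset_eq) auto
  then show ?thesis by (auto simp: edges_complete_graph two)
qed

lemma vertices_copies_K2:
  "vertices (disjoint_copies k (complete_graph 2)) = {..<k} \<times> {0, 1}"
  by (auto simp: disjoint_copies_def complete_graph_def)

lemma edges_copies_K2:
  "edges (disjoint_copies k (complete_graph 2)) = (\<lambda>i. {(i, 0), (i, 1)}) ` {..<k}"
proof -
  have "edges (disjoint_copies k (complete_graph 2)) = {Pair i ` {0, 1} | i. i < k}"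
    unfolding disjoint_copies_def edges_complete_graph_2 by simp
  then show ?thesis by auto
qed

lemma copy_of_copies_K2_is_matching:
  assumes "subgraph G' G" and "graph_iso (disjoint_copies k (complete_graph 2)) G'"
  shows "edges G' \<in> matchings k G"
proof -
  obtain f where f: "bij_betw f ({..<k} \<times> {0, 1::nat}) (vertices G')"
    and E: "edges G' = (\<lambda>e. f ` e) ` (\<lambda>i. {(i, 0), (i, 1)}) ` {..<k}"
    using assms(2) unfolding graph_iso_def vertices_copies_K2 edges_copies_K2 by auto
  have inj: "inj_on f ({..<k} \<times> {0, 1})"
    using f by (rule bij_betw_imp_inj_on)
  define h where "h i = {f (i, 0), f (i, 1)}" for i
  have Eh: "edges G' = h ` {..<k}"
    by (simp add: E image_image h_def)
  have dis: "disjnt (h i) (h j)" if "i < k" "j < k" "i \<noteq> j" for i j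
    using that inj_onD[OF inj] by (fastforce simp: h_def disjnt_def)
  have "inj_on h {..<k}"
  proof (rule inj_onI, rule ccontr)
    fix i j assume "i \<in> {..<k}" "j \<in> {..<k}" "h i = h j" "i \<noteq> j"
    then have "disjnt (h i) (h i)" using dis[of i j] by simp
    then show False by (simp add: h_def disjnt_def)
  qed
  then have "card (edges G') = k"
    by (simp add: Eh card_image)
  moreover have "pairwise disjnt (edges G')"
    unfolding Eh pairwise_def using dis by blast
  moreover have "edges G' \<subseteq> edges G"
    using assms(1) by (simp add: subgraph_def)
  ultimately show ?thesis
    by (simp add: matchings_def Eh)
qed

text \<open>The matching is realised as the graph \<open>(\<Union> X, X)\<close>, which has no
  isolated vertices. Numbering its edges and naming the ends of each \<open>a i\<close> and
  \<open>b i\<close> gives the isomorphism; disjointness of the edges makes it injective.\<close>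

lemma matching_is_copy_of_copies_K2:
  assumes G: "simple_graph G" and X: "X \<in> matchings k G"
  shows "X \<in> copies_in (disjoint_copies k (complete_graph 2)) G"
proof -
  have XE: "X \<subseteq> edges G" and fin: "finite X" and card: "card X = k"
    and dis: "pairwise disjnt X"
    using X by (auto simp: matchings_def)
  have edge: "card e = 2 \<and> e \<subseteq> vertices G" if "e \<in> X" for e
    using that XE G by (auto simp: simple_graph_def)
  obtain g where g: "bij_betw g {..<k} X"
    using ex_bij_betw_nat_finite[OF fin] card by (auto simp: atLeast0LessThan)
  have gX: "g i \<in> X" if "i < k" for i
    using g that by (auto simp: bij_betw_def)
  have "\<exists>a b. a \<noteq> b \<and> g i = {a, b}" if "i < k" for i
    using edge[OF gX[OF that]] by (auto simp: card_2_iff)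
  then obtain a b where ab: "\<And>i. i < k \<Longrightarrow> a i \<noteq> b i \<and> g i = {a i, b i}"
    by metis
  define f where "f = (\<lambda>(i, j::nat). if j = 0 then a i else b i)"
  have f_in: "f (i, j) \<in> g i" if "i < k" for i j
    using ab[OF that] by (auto simp: f_def)
  have inj: "inj_on f ({..<k} \<times> {0, 1})"
  proof (rule inj_onI)
    fix p q assume p: "p \<in> {..<k} \<times> {0, 1::nat}" and q: "q \<in> {..<k} \<times> {0, 1::nat}"
      and eq: "f p = f q"
    obtain i s where ps: "p = (i, s)" "i < k" "s = 0 \<or> s = 1" using p by auto
    obtain j t where qt: "q = (j, t)" "j < k" "t = 0 \<or> t = 1" using q by auto
    have "\<not> disjnt (g i) (g j)"
      using f_in[OF ps(2), of s] f_in[OF qt(2), of t] eq ps(1) qt(1) by (auto simp: disjnt_def)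
    then have "g i = g j"
      using dis gX[OF ps(2)] gX[OF qt(2)] by (auto simp: pairwise_def)
    then have ij: "i = j"
      using g ps(2) qt(2) by (auto simp: bij_betw_def dest: inj_onD)
    show "p = q"
      using eq ab[OF ps(2)] ps qt ij by (auto simp: f_def)
  qed
  have img: "f ` {(i, 0), (i, 1)} = g i" if "i < k" for i
    using ab[OF that] by (auto simp: f_def)
  have "f ` ({..<k} \<times> {0, 1}) = (\<Union>i<k. f ` {(i, 0), (i, 1)})"
    by auto
  also have "\<dots> = \<Union> (g ` {..<k})"
    using img by auto
  also have "\<dots> = \<Union> X"
    using g by (simp add: bij_betw_def)
  finally have "f ` ({..<k} \<times> {0, 1}) = \<Union> X" .
  with inj have bij: "bij_betw f ({..<k} \<times> {0, 1}) (\<Union> X)"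
    by (simp add: bij_betw_def)
  have "(\<lambda>e. f ` e) ` (\<lambda>i. {(i, 0), (i, 1)}) ` {..<k} = g ` {..<k}"
    unfolding image_image by (rule image_cong) (auto simp only: img lessThan_iff)
  then have "X = (\<lambda>e. f ` e) ` (\<lambda>i. {(i, 0), (i, 1)}) ` {..<k}"
    using g by (simp add: bij_betw_def)
  with bij have "graph_iso (disjoint_copies k (complete_graph 2)) (\<Union> X, X)"
    unfolding graph_iso_def vertices_copies_K2 edges_copies_K2 fst_conv snd_conv by blast
  moreover have "finite (\<Union> X)"
    using edge fin G by (auto intro: finite_subset simp: simple_graph_def)
  then have "subgraph (\<Union> X, X) G"
    using edge XE by (auto simp: subgraph_def simple_graph_def)
  ultimately show ?thesis
    by (force simp: copies_in_def)
qed

lemma copies_in_disjoint_copies_K2: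
  assumes "simple_graph G"
  shows "copies_in (disjoint_copies k (complete_graph 2)) G = matchings k G"
proof (rule set_eqI, rule iffI)
  show "X \<in> matchings k G" if "X \<in> copies_in (disjoint_copies k (complete_graph 2)) G" for X
    using that copy_of_copies_K2_is_matching unfolding copies_in_def by blast
qed (rule matching_is_copy_of_copies_K2[OF assms])

section \<open>Matchings in complete graphs and sets closed under completion\<close>

lemma simple_complete_graph: "simple_graph (complete_graph n)"
  by (auto simp: simple_graph_def complete_graph_def)

lemma matchings_complete_graph_nonempty:
  assumes "2 * k \<le> n"
  shows "matchings k (complete_graph n) \<noteq> {}"
proof -
  define h where "h i = {2 * i, 2 * i + 1}" for i :: nat
  have dis: "disjnt (h i) (h j)" if "i \<noteq> j" for i j
    using that by (simp add: h_def disjnt_def)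
  have "inj h"
  proof (rule injI)
    fix i j assume "h i = h j"
    then show "i = j" using dis[of i j] by (auto simp: h_def disjnt_def)
  qed
  then have "card (h ` {..<k}) = k"
    by (simp add: card_image inj_on_subset)
  moreover have "h ` {..<k} \<subseteq> edges (complete_graph n)"
    using assms by (auto simp: h_def edges_complete_graph)
  moreover have "pairwise disjnt (h ` {..<k})"
    using dis by (intro pairwiseI) (metis imageE)
  ultimately have "h ` {..<k} \<in> matchings k (complete_graph n)"
    by (simp add: matchings_def)
  then show ?thesis by blast
qed

text \<open>Since \<open>e \<notin> Y\<close>, the set \<open>Y\<close> has exactly
  \<open>k - 1\<close> elements. The notion abstracts what the rank bound and the construction of an
  optimal sequence have in common.\<close>

definition matching_closed :: "nat \<Rightarrow> 'v graph \<Rightarrow> 'v set set \<Rightarrow> bool" where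
  "matching_closed k G C \<longleftrightarrow>
     (\<forall>Y e. Y \<subseteq> C \<and> e \<notin> Y \<and> insert e Y \<in> matchings k G \<longrightarrow> e \<in> C)"

text \<open>A nonempty set is not disjoint from itself, so \<open>e\<close> lies outside
  \<open>X - {f}\<close> and the exchange keeps the size \<open>k\<close>. The case
  \<open>e = f\<close> is included.\<close>

lemma matching_exchange:
  assumes X: "X \<in> matchings k G" and f: "f \<in> X" and e: "e \<in> edges G" "e \<noteq> {}"
    and dis: "\<And>g. g \<in> X - {f} \<Longrightarrow> disjnt e g"
  shows "e \<notin> X - {f}" and "insert e (X - {f}) \<in> matchings k G"
proof -
  show new: "e \<notin> X - {f}"
    using dis[of e] e(2) by (auto simp: disjnt_def)
  have "card (insert e (X - {f})) = card X"
    using new X f card_Suc_Diff1[of X f] by (simp add: matchings_def del: Diff_iff card_Diff_insert)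
  moreover have "pairwise disjnt (insert e (X - {f}))"
    using X dis pairwise_subset[of disjnt X "X - {f}"]
    by (auto simp: matchings_def pairwise_insert disjnt_iff)
  ultimately show "insert e (X - {f}) \<in> matchings k G"
    using X e by (auto simp: matchings_def)
qed

lemma matching_closed_exchange:
  assumes "matching_closed k G C" and "X \<subseteq> C"
    and "X \<in> matchings k G" and "f \<in> X" and "e \<in> edges G" "e \<noteq> {}"
    and "\<And>g. g \<in> X - {f} \<Longrightarrow> disjnt e g"
  shows "e \<in> C"
proof -
  have "X - {f} \<subseteq> C"
    using assms(2) by blast
  moreover have "e \<notin> X - {f}" "insert e (X - {f}) \<in> matchings k G"
    by (rule matching_exchange[OF assms(3-6)]; use assms(7) in simp)+
  ultimately show ?thesis
    using assms(1) unfolding matching_closed_def by (elim allE[of _ "X - {f}"] allE[of _ e]) simp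
qed

lemma matching_closed_eq_edges:
  assumes k: "k \<ge> 1" and n: "n \<ge> 2 * k + 1"
    and C: "matching_closed k (complete_graph n) C" "C \<subseteq> edges (complete_graph n)"
    and X: "X \<in> matchings k (complete_graph n)" "X \<subseteq> C"
  shows "C = edges (complete_graph n)"
proof -
  let ?G = "complete_graph n"
  have Xfin: "finite X" and Xcard: "card X = k" and XE: "X \<subseteq> edges ?G"
    and Xdis: "pairwise disjnt X"
    using X(1) by (auto simp: matchings_def)
  have meet: "g = g'" if "g \<in> X" "g' \<in> X" "x \<in> g" "x \<in> g'" for g g' x
    using Xdis that by (auto simp: pairwise_def disjnt_def)
  have "e \<in> C" if e: "e \<in> edges ?G" for e
  proof (cases "\<exists>f\<in>X. \<forall>g\<in>X - {f}. disjnt e g")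
    case True
    moreover have "e \<noteq> {}" using e by (auto simp: edges_complete_graph)
    ultimately show ?thesis
      using matching_closed_exchange[OF C(1) X(2) X(1) _ e] by blast
  next
    case False
    obtain u v where uv: "e = {u, v}" "u \<noteq> v"
      using e by (auto simp: edges_complete_graph card_2_iff)
    \<comment> \<open>Here each edge of \<open>X\<close> leaves another one that meets
      \<open>e\<close>. As \<open>X\<close> is nonempty, applying this twice yields two distinct
      edges of \<open>X\<close> that meet \<open>e\<close>.\<close>
    obtain f0 where "f0 \<in> X"
      using Xcard k by fastforce
    then obtain f1 where "f1 \<in> X" "\<not> disjnt e f1"
      using False by blast
    then obtain f2 where "f2 \<in> X" "f2 \<noteq> f1" "\<not> disjnt e f2"
      using False by blast
    \<comment> \<open>Each end of \<open>e\<close> lies in at most one edge of \<open>X\<close>, so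
      the two edges found contain different ends of \<open>e\<close>.\<close>
    obtain f g where f: "f \<in> X" "u \<in> f" and g: "g \<in> X" "v \<in> g" and fg: "f \<noteq> g"
      using \<open>f1 \<in> X\<close> \<open>\<not> disjnt e f1\<close> \<open>f2 \<in> X\<close> \<open>f2 \<noteq> f1\<close> \<open>\<not> disjnt e f2\<close> meet
      unfolding uv disjnt_def by blast
    have "card f = 2" "f \<subseteq> {..<n}"
      using f XE by (auto simp: edges_complete_graph)
    then obtain u' where u': "f = {u, u'}" "u' \<noteq> u" "u' < n"
      using f(2) by (auto simp: card_2_iff)
    \<comment> \<open>\<open>X\<close> covers at most \<open>2 * k\<close> vertices, so
      \<open>n \<ge> 2 * k + 1\<close> leaves a vertex \<open>w\<close> free.\<close>
    have "card (\<Union> X) \<le> sum card X"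
      by (rule card_Union_le_sum_card)
    also have "\<dots> = 2 * k"
      using XE Xcard by (subst sum.cong[OF refl, of _ _ "\<lambda>_. 2"]) (auto simp: edges_complete_graph)
    finally have "card (\<Union> X) < card {..<n}"
      using n by simp
    moreover have "finite (\<Union> X)"
      by (rule finite_subset[of _ "{..<n}"]) (use XE in \<open>auto simp: edges_complete_graph\<close>)
    ultimately obtain w where w: "w < n" "w \<notin> \<Union> X"
      using card_mono[of "\<Union> X" "{..<n}"] by (meson leD lessThan_iff subsetI)
    \<comment> \<open>Trading \<open>{u, u'}\<close> for \<open>{u', w}\<close> frees
      \<open>u\<close>. Then \<open>g\<close> is the only edge of \<open>X'\<close> that meets
      \<open>e\<close>, and \<open>e\<close> can be exchanged for it.\<close>
    define X' where "X' = insert {u', w} (X - {f})"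
    have wu': "w \<noteq> u'" using w f u' by blast
    have new: "{u', w} \<in> edges ?G"
      using wu' w u' by (auto simp: edges_complete_graph)
    have dis: "disjnt {u', w} h" if "h \<in> X - {f}" for h
      using that w meet[OF f(1)] u' by (auto simp: disjnt_def)
    have "{u', w} \<in> C"
      by (rule matching_closed_exchange[OF C(1) X(2) X(1) f(1) new]) (use dis in auto)
    then have X'C: "X' \<subseteq> C" using X(2) by (auto simp: X'_def)
    have X': "X' \<in> matchings k ?G"
      unfolding X'_def by (rule matching_exchange(2)[OF X(1) f(1) new]) (use dis in auto)
    have gX': "g \<in> X'" using g fg by (simp add: X'_def)
    have wu: "w \<noteq> u" using w f by blast
    have vw: "v \<noteq> w" using w g by blast
    have vu': "v \<noteq> u'" using meet[OF f(1) g(1)] u' g(2) fg by blast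
    have "disjnt e h" if h: "h \<in> X' - {g}" for h
    proof (cases "h = {u', w}")
      case True
      then show ?thesis using uv wu vw vu' u'(2) by (auto simp: disjnt_def)
    next
      case False
      then have "h \<in> X" "h \<noteq> f" "h \<noteq> g" using h by (auto simp: X'_def)
      then show ?thesis
        using uv(1) meet[OF f(1) _ f(2), of h] meet[OF g(1) _ g(2), of h] by (auto simp: disjnt_def)
    qed
    then show ?thesis
      using matching_closed_exchange[OF C(1) X'C X' gX' e] uv by blast
  qed
  then show ?thesis using C(2) by blast
qed

section \<open>Uniform matroids and the rank of matroids with matchings as circuits\<close>

lemma matroid_uniform: "finite E \<Longrightarrow> matroid E (uniform_matroid r E)"
  unfolding matroid_def
proof (intro conjI allI impI)
  assume E: "finite E"
  fix X Y :: "'a set"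
  {
    assume "X \<in> uniform_matroid r E \<and> Y \<subseteq> X"
    then show "Y \<in> uniform_matroid r E"
      using finite_subset[OF _ E, of X] card_mono[of X Y] by (fastforce simp: uniform_matroid_def)
  next
    assume XY: "X \<in> uniform_matroid r E \<and> Y \<in> uniform_matroid r E \<and> card X < card Y"
    then have "finite X" using E by (auto simp: uniform_matroid_def intro: finite_subset)
    with XY have "\<not> Y \<subseteq> X" using card_mono[of X Y] by auto
    then obtain e where "e \<in> Y - X" by blast
    with XY \<open>finite X\<close> show "\<exists>e\<in>Y - X. insert e X \<in> uniform_matroid r E"
      by (intro bexI[of _ e]) (auto simp: uniform_matroid_def)
  }
qed (auto simp: uniform_matroid_def)

lemma circuit_uniform:
  assumes "finite E" and "C \<subseteq> E" and "card C = Suc r"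
  shows "circuit E (uniform_matroid r E) C"
proof -
  have "card D \<le> r" if "D \<subset> C" for D
    using psubset_card_mono[OF finite_subset[OF assms(2,1)] that] assms(3) by simp
  then show ?thesis
    using assms by (auto simp: circuit_def uniform_matroid_def)
qed

text \<open>A copy has \<open>k\<close> edges, one more than the rank \<open>k - 1\<close>, and such
  sets are circuits of the uniform matroid.\<close>

lemma H_matroid_uniform:
  assumes "k \<ge> 1"
  shows "H_matroid (disjoint_copies k (complete_graph 2)) (complete_graph n)
           (uniform_matroid (k - 1) (edges (complete_graph n)))"
  unfolding H_matroid_def copies_in_disjoint_copies_K2[OF simple_complete_graph]
proof (intro conjI ballI)
  show "circuit (edges (complete_graph n)) (uniform_matroid (k - 1) (edges (complete_graph n))) C"
    if "C \<in> matchings k (complete_graph n)" for C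
    using that assms by (intro circuit_uniform finite_edges_complete_graph) (auto simp: matchings_def)
qed (rule matroid_uniform[OF finite_edges_complete_graph])

lemma matroid_augment:
  assumes "matroid E M" "X \<in> M" "Y \<in> M" "card X < card Y"
  obtains e where "e \<in> Y" "e \<notin> X" "insert e X \<in> M"
proof -
  have "\<exists>e\<in>Y - X. insert e X \<in> M"
    using assms by (simp add: matroid_def)
  with that show ?thesis by blast
qed

text \<open>Transitivity of span: \<open>Z\<close> lies in the span of \<open>B\<close>, and
  \<open>e\<close> in the span of \<open>Z\<close>. As the two independent sets have equal size, two
  augmentations give the result.\<close>

lemma matroid_span_closed:
  assumes M: "matroid E M"
    and B: "B \<in> M" and Z: "Z \<in> M" "card Z = card B"
    and Zspan: "\<And>z. z \<in> Z - B \<Longrightarrow> insert z B \<notin> M"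
    and e: "insert e Z \<notin> M" "e \<notin> B"
  shows "insert e B \<notin> M"
proof
  assume I: "insert e B \<in> M"
  have fin: "finite A" if "A \<in> M" for A
    using M that by (auto simp: matroid_def intro: finite_subset)
  \<comment> \<open>\<open>x\<close> is not \<open>e\<close>, since \<open>insert e Z\<close> is
    dependent, so \<open>x\<close> lies in \<open>B\<close>. The next augmentation must therefore
    take an element of \<open>Z - B\<close>, and none of these extends \<open>B\<close>.\<close>
  obtain x where x: "x \<in> insert e B" "x \<notin> Z" "insert x Z \<in> M"
    by (rule matroid_augment[OF M Z(1) I]) (use Z(2) e(2) fin[OF B] in auto)
  with e(1) have xB: "x \<in> B" by auto
  obtain y where "y \<in> insert x Z" "y \<notin> B" "insert y B \<in> M"
    by (rule matroid_augment[OF M B x(3)]) (use Z(2) x(2) fin[OF Z(1)] in auto)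
  with Zspan xB show False by blast
qed

lemma H_matroid_le_uniform:
  assumes k: "k \<ge> 1" and n: "n \<ge> 2 * k + 1"
    and M: "H_matroid (disjoint_copies k (complete_graph 2)) (complete_graph n) M"
  shows "M \<preceq>\<^sub>w uniform_matroid (k - 1) (edges (complete_graph n))"
proof -
  let ?G = "complete_graph n"
  let ?E = "edges ?G"
  have mat: "matroid ?E M" and circ: "\<And>X. X \<in> matchings k ?G \<Longrightarrow> circuit ?E M X"
    using M by (auto simp: H_matroid_def copies_in_disjoint_copies_K2[OF simple_complete_graph])
  obtain X where X: "X \<in> matchings k ?G"
    using matchings_complete_graph_nonempty[of k n] n by auto
  then have Xc: "finite X" "card X = k" "X \<subseteq> ?E"
    by (auto simp: matchings_def)
  then obtain f where f: "f \<in> X" using k by fastforce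
  define B where "B = X - {f}"
  have B: "B \<in> M" "card B = k - 1" "B \<subseteq> ?E"
    using circ[OF X] f Xc by (auto simp: B_def circuit_def)
  \<comment> \<open>\<open>C\<close> is the span of \<open>B\<close>. The first disjunct matters
    because \<open>insert e B = B\<close> is independent for \<open>e \<in> B\<close>.\<close>
  define C where "C = {e \<in> ?E. e \<in> B \<or> insert e B \<notin> M}"
  have "insert f B = X" using f by (auto simp: B_def)
  then have XC: "X \<subseteq> C"
    using circ[OF X] Xc by (auto simp: C_def B_def circuit_def)
  have "matching_closed k ?G C"
    unfolding matching_closed_def
  proof (intro allI impI)
    fix Z e assume *: "Z \<subseteq> C \<and> e \<notin> Z \<and> insert e Z \<in> matchings k ?G"
    then have Z: "finite Z" "card Z = k - 1" "e \<in> ?E" "Z \<subseteq> ?E"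
      by (auto simp: matchings_def)
    \<comment> \<open>\<open>Z\<close> is independent as a proper subset of the circuit
      \<open>insert e Z\<close>. It has the size of \<open>B\<close> and lies in its span, so
      transitivity of span applies.\<close>
    have dep: "insert e Z \<notin> M" and "Z \<in> M"
      using circ[of "insert e Z"] * by (auto simp: circuit_def)
    then show "e \<in> C"
      using matroid_span_closed[OF mat B(1), of Z e] * Z B(2) by (auto simp: C_def)
  qed
  then have CE: "C = ?E"
    using matching_closed_eq_edges[OF k n _ _ X XC] by (auto simp: C_def)
  \<comment> \<open>A larger independent set would augment \<open>B\<close> by an edge outside its
    span, but the span is all of \<open>?E\<close>.\<close>
  have "card Y \<le> k - 1" if Y: "Y \<in> M" for Y
  proof (rule ccontr)
    assume "\<not> card Y \<le> k - 1"
    then obtain e where e: "e \<in> Y" "e \<notin> B" "insert e B \<in> M"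
      using matroid_augment[OF mat B(1) Y] B(2) by (metis not_le)
    then have "e \<in> C" using mat Y CE by (auto simp: matroid_def)
    with e show False by (auto simp: C_def)
  qed
  then show ?thesis
    using mat by (auto simp: weak_le_def uniform_matroid_def matroid_def)
qed

section \<open>Proper sequences and their values\<close>

lemma proper_seq_snoc:
  "proper_seq \<X> (S @ [X]) \<longleftrightarrow>
     proper_seq \<X> S \<and> X \<in> \<X> \<and> (S = [] \<or> \<not> X \<subseteq> \<Union> (set S))"
proof -
  let ?new = "\<lambda>T i. \<not> T ! i \<subseteq> (\<Union>j<i. T ! j)"
  have "(\<Union>j<i. (S @ [X]) ! j) = (\<Union>j<i. S ! j)" if "i \<le> length S" for i
    by (rule SUP_cong) (use that in \<open>auto simp: nth_append\<close>)
  then have old: "?new (S @ [X]) i \<longleftrightarrow> ?new S i" if "i < length S" for i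
    using that by (simp add: nth_append)
  have "(\<Union>j<length S. (S @ [X]) ! j) = (\<Union>j<length S. S ! j)"
    by (rule SUP_cong) (auto simp: nth_append)
  also have "\<dots> = \<Union> (set S)"
    by (auto simp: set_conv_nth)
  finally have last: "?new (S @ [X]) (length S) \<longleftrightarrow> \<not> X \<subseteq> \<Union> (set S)"
    by simp
  \<comment> \<open>Only the index \<open>length S\<close> is new, and its condition is void when
    \<open>S = []\<close>, as a first member is unrestricted.\<close>
  have "(\<forall>i. 1 \<le> i \<and> i < length (S @ [X]) \<longrightarrow> ?new (S @ [X]) i) \<longleftrightarrow>
      (\<forall>i. 1 \<le> i \<and> i < length S \<longrightarrow> ?new (S @ [X]) i) \<and>
      (1 \<le> length S \<longrightarrow> ?new (S @ [X]) (length S))"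
    unfolding length_append_singleton less_Suc_eq by blast
  also have "\<dots> \<longleftrightarrow> (\<forall>i. 1 \<le> i \<and> i < length S \<longrightarrow> ?new S i) \<and>
      (S = [] \<or> \<not> X \<subseteq> \<Union> (set S))"
    unfolding last using old by (metis One_nat_def Suc_le_eq length_greater_0_conv)
  finally show ?thesis
    unfolding proper_seq_def by auto
qed

text \<open>The first member contributes \<open>k\<close> elements and each later one at least one
  new element. The bound is written with \<open>Suc\<close> to avoid subtraction.\<close>

lemma proper_seq_card_Union:
  assumes "proper_seq \<X> S" and "S \<noteq> []" and "\<And>X. X \<in> \<X> \<Longrightarrow> finite X \<and> card X = k"
  shows "length S + k \<le> Suc (card (\<Union> (set S)))"
  using assms(1,2)
proof (induction S rule: rev_induct)
  case (snoc X S)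
  then have S: "proper_seq \<X> S" and X: "X \<in> \<X>" and new: "S = [] \<or> \<not> X \<subseteq> \<Union> (set S)"
    by (auto simp: proper_seq_snoc)
  show ?case
  proof (cases "S = []")
    case True
    then show ?thesis using X assms(3) by simp
  next
    case False
    have "finite (\<Union> (set (S @ [X])))"
      using S X assms(3) by (auto simp: proper_seq_def)
    moreover have "\<Union> (set S) \<subset> \<Union> (set (S @ [X]))"
      using new False by auto
    ultimately have "card (\<Union> (set S)) < card (\<Union> (set (S @ [X])))"
      by (rule psubset_card_mono)
    with snoc.IH[OF S False] show ?thesis by simp
  qed
qed simp

text \<open>The last equation makes \<open>seq_val F S\<close> equal to \<open>k - 1\<close> for
  every \<open>F\<close> inside the union, the least value that a nonempty proper sequence can
  have.\<close>

lemma spanning_proper_seq: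
  assumes k: "k \<ge> 1" and n: "n \<ge> 2 * k + 1"
  obtains S where "proper_seq (matchings k (complete_graph n)) S"
    and "\<Union> (set S) = edges (complete_graph n)"
    and "Suc (card (\<Union> (set S))) = length S + k"
proof -
  let ?G = "complete_graph n"
  let ?X = "matchings k ?G"
  \<comment> \<open>\<open>P\<close> describes equality in \<open>proper_seq_card_Union\<close>:
    every member after the first adds exactly one element.\<close>
  define P where "P S \<longleftrightarrow> proper_seq ?X S \<and> S \<noteq> [] \<and> Suc (card (\<Union> (set S))) = length S + k" for S
  have sub: "\<Union> (set S) \<subseteq> edges ?G" if "P S" for S
    using that by (auto simp: P_def proper_seq_def matchings_def)
  obtain X0 where "X0 \<in> ?X"
    using matchings_complete_graph_nonempty[of k n] n by auto
  then have P0: "P [X0]"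
    using proper_seq_snoc[of ?X "[]" X0] by (auto simp: P_def proper_seq_def matchings_def)
  have "length S \<le> Suc (card (edges ?G))" if "P S" for S
    using that card_mono[OF finite_edges_complete_graph sub[OF that]] by (simp add: P_def)
  then obtain S where S: "P S" and max: "\<And>T. P T \<Longrightarrow> length T \<le> length S"
    using ex_has_greatest_nat[of P "[X0]" length] P0 by (metis le_imp_less_Suc)
  define C where "C = \<Union> (set S)"
  have finC: "finite C"
    using sub[OF S] finite_edges_complete_graph by (auto simp: C_def intro: finite_subset)
  have "matching_closed k ?G C"
    unfolding matching_closed_def
  proof (intro allI impI, rule ccontr)
    fix Y e assume *: "Y \<subseteq> C \<and> e \<notin> Y \<and> insert e Y \<in> ?X" and "e \<notin> C"
    then have "\<Union> (set (S @ [insert e Y])) = insert e C"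
      by (auto simp: C_def)
    \<comment> \<open>The missing edge \<open>e\<close> is the only new element of the copy
      \<open>insert e Y\<close>, so appending this copy preserves \<open>P\<close>, against the
      maximal length of \<open>S\<close>.\<close>
    then have "P (S @ [insert e Y])"
      using S * \<open>e \<notin> C\<close> finC unfolding P_def proper_seq_snoc by (auto simp: C_def)
    from max[OF this] show False by simp
  qed
  moreover have "hd S \<in> ?X" "hd S \<subseteq> C"
    using S by (auto simp: P_def C_def proper_seq_def)
  ultimately have "C = edges ?G"
    using matching_closed_eq_edges[OF k n] sub[OF S] by (simp add: C_def)
  then show ?thesis
    using that[of S] S by (auto simp: P_def C_def)
qed

lemma matroid_rank_uniform:
  assumes "finite F" and "F \<subseteq> E"
  shows "matroid_rank (uniform_matroid r E) F = min (card F) r"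
  unfolding matroid_rank_def
proof (rule Max_eqI)
  show "finite {card X | X. X \<in> uniform_matroid r E \<and> X \<subseteq> F}"
    using assms(1) by simp
  show "c \<le> min (card F) r" if "c \<in> {card X | X. X \<in> uniform_matroid r E \<and> X \<subseteq> F}" for c
    using that card_mono[OF assms(1)] by (auto simp: uniform_matroid_def)
  obtain X where "X \<subseteq> F" "card X = min (card F) r"
    by (rule obtain_subset_with_card_n[of "min (card F) r" F]) auto
  then show "min (card F) r \<in> {card X | X. X \<in> uniform_matroid r E \<and> X \<subseteq> F}"
    using assms(2) by (auto simp: uniform_matroid_def intro!: exI[of _ X])
qed

lemma val_in_disjoint_copies_K2:
  assumes k: "k \<ge> 1" and n: "n \<ge> 2 * k + 1" and F: "F \<subseteq> edges (complete_graph n)"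
  shows "val_in (disjoint_copies k (complete_graph 2)) (complete_graph n) F
           = int (min (card F) (k - 1))"
proof -
  let ?G = "complete_graph n"
  let ?X = "matchings k ?G"
  let ?V = "{seq_val F S | S. proper_seq ?X S}"
  have fin: "finite (F \<union> \<Union> (set S))" and sub: "F \<union> \<Union> (set S) \<subseteq> edges ?G"
    if "proper_seq ?X S" for S
  proof -
    show "F \<union> \<Union> (set S) \<subseteq> edges ?G"
      using that F by (auto simp: proper_seq_def matchings_def)
    then show "finite (F \<union> \<Union> (set S))"
      using finite_edges_complete_graph by (rule finite_subset)
  qed
  have lower: "int (min (card F) (k - 1)) \<le> seq_val F S" if S: "proper_seq ?X S" for S
  proof (cases "S = []")
    case False
    have "length S + k \<le> Suc (card (\<Union> (set S)))"
      by (rule proper_seq_card_Union[OF S False]) (auto simp: matchings_def)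
    moreover have "card (\<Union> (set S)) \<le> card (F \<union> \<Union> (set S))"
      using fin[OF S] by (intro card_mono) auto
    ultimately have "min (card F) (k - 1) + length S \<le> card (F \<union> \<Union> (set S))"
      using k by linarith
    then show ?thesis unfolding seq_val_def by linarith
  qed (simp add: seq_val_def)
  \<comment> \<open>\<open>Min\<close> is meaningful only for a finite set of values, so an upper
    bound is required as well.\<close>
  have upper: "seq_val F S \<le> int (card (edges ?G))" if S: "proper_seq ?X S" for S
    using card_mono[OF finite_edges_complete_graph sub[OF S]] by (simp add: seq_val_def)
  have "?V \<subseteq> {0..int (card (edges ?G))}"
    using lower upper by fastforce
  then have "finite ?V" by (rule finite_subset) simp
  \<comment> \<open>The empty sequence, of value \<open>card F\<close>, attains the minimum if
    \<open>card F \<le> k - 1\<close>. Otherwise a spanning sequence does, as its union absorbs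
    \<open>F\<close>.\<close>
  moreover have "int (min (card F) (k - 1)) \<in> ?V"
  proof (cases "card F \<le> k - 1")
    case True
    then have "seq_val F [] = int (min (card F) (k - 1))"
      by (simp add: seq_val_def)
    moreover have "proper_seq ?X []" by (simp add: proper_seq_def)
    ultimately show ?thesis by (metis (mono_tags, lifting) mem_Collect_eq)
  next
    case False
    obtain S where S: "proper_seq ?X S" "\<Union> (set S) = edges ?G"
      "Suc (card (\<Union> (set S))) = length S + k"
      using spanning_proper_seq[OF k n] by blast
    then have "F \<union> \<Union> (set S) = \<Union> (set S)" using F by auto
    then have "seq_val F S = int (min (card F) (k - 1))"
      using S(3) False k unfolding seq_val_def by simp
    then show ?thesis using S(1) by (metis (mono_tags, lifting) mem_Collect_eq)
  qed
  ultimately show ?thesis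
    unfolding val_in_def copies_in_disjoint_copies_K2[OF simple_complete_graph]
    using lower by (intro Min_eqI) auto
qed

theorem theorem3p4:
  fixes k n :: nat
  assumes "k \<ge> 1" and "n \<ge> 2 * k + 1"
  defines "H \<equiv> disjoint_copies k (complete_graph 2)"
    and "K \<equiv> complete_graph n"
  defines "U \<equiv> uniform_matroid (k - 1) (edges K)"
  shows "maximal_H_matroid H K U
     \<and> (\<forall>M. maximal_H_matroid H K M \<longrightarrow> M = U)
     \<and> (\<forall>F. F \<subseteq> edges K \<longrightarrow> val_in H K F = int (matroid_rank U F))"
proof (intro conjI allI impI)
  have U: "H_matroid H K U"
    unfolding H_def K_def U_def by (rule H_matroid_uniform[OF assms(1)])
  \<comment> \<open>This makes \<open>U\<close> the greatest \<open>H\<close>-matroid in the weak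
    order, which yields both maximality and uniqueness.\<close>
  have le: "M \<preceq>\<^sub>w U" if "H_matroid H K M" for M
    using H_matroid_le_uniform[OF assms(1,2)] that unfolding H_def K_def U_def by blast
  show "maximal_H_matroid H K U"
    unfolding maximal_H_matroid_def
  proof (intro conjI allI impI U)
    fix M assume "H_matroid H K M \<and> U \<preceq>\<^sub>w M"
    with le[of M] show "M = U" unfolding weak_le_def by blast
  qed
  show "M = U" if "maximal_H_matroid H K M" for M
    using that U le[of M] unfolding maximal_H_matroid_def by blast
  show "val_in H K F = int (matroid_rank U F)" if F: "F \<subseteq> edges K" for F
  proof -
    have "finite F"
      using F finite_edges_complete_graph unfolding K_def by (rule finite_subset)
    then show ?thesis
      using F val_in_disjoint_copies_K2[OF assms(1,2)]
      unfolding H_def K_def U_def by (simp add: matroid_rank_uniform)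
  qed
qed

end
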